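(* Let $f(x_1,\ldots,x_n)$ be a factor over binary variables $x_1,\ldots,x_n$, i.e. a function $f:\{0,1\}^n\to\mathbb{R}$. Fix $i\in\{1,\ldots,n\}$ and $\gamma_i\in\mathbb{R}$, and let $g(x_i)=\gamma_i x_i$ be a factor defined only over the variable $x_i$. Let $h(x_1,\ldots,x_n)=f(x_1,\ldots,x_n)+g(x_i)$. Then for every $j\in\{1,\ldots,n\}$ and all $\nu_1,\ldots,\nu_n\in\mathbb{R}$, $$\nu_{h\rightarrow x_j}(\nu_1,\ldots,\nu_n)=\begin{cases}\nu_{f\rightarrow x_j}(\nu_1,\ldots,\nu_{i-1},\nu_i+\gamma_i,\nu_{i+1},\ldots,\nu_n) & \text{if } j\neq i,\\ \nu_{f\rightarrow x_j}(\nu_1,\ldots,\nu_{i-1},\nu_i+\gamma_i,\nu_{i+1},\ldots,\nu_n)+\gamma_i & \text{if } j=i.\end{cases}$$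
   Context: A factor over binary variables $x_1,\ldots,x_n$ is a real-valued function on $\{0,1\}^n$. For any such factor $F$, any $j\in\{1,\ldots,n\}$, any $b\in\{0,1\}$ and real numbers $\nu_1,\ldots,\nu_n$, define $$\mu_{F\rightarrow x_j}(b,\nu_1,\ldots,\nu_n)=\min_{\substack{(x_1,\ldots,x_n)\in\{0,1\}^n\\ x_j=b}}\Big(F(x_1,\ldots,x_n)+\sum_{k\neq j}\nu_k x_k\Big),$$ that is, the minimum is over all assignments of the variables other than $x_j$, with $x_j$ fixed to $b$. Define also $$\nu_{F\rightarrow x_j}(\nu_1,\ldots,\nu_n)=\mu_{F\rightarrow x_j}(1,\nu_1,\ldots,\nu_n)-\mu_{F\rightarrow x_j}(0,\nu_1,\ldots,\nu_n).$$ These definitions are applied with $F=f$ and with $F=h$. *)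

theory Defs
  imports Complex_Main "HOL-Library.FuncSet"
begin

text \<open>
  The set \<open>{0,1}\<^sup>n\<close>: an assignment is a function on the index set \<open>{1..n}\<close>, extended by
  \<open>undefined\<close> outside it. A factor is a function \<open>F :: (nat \<Rightarrow> nat) \<Rightarrow> real\<close> of which only the
  values on \<open>cube n\<close> are relevant.
\<close>

definition cube :: "nat \<Rightarrow> (nat \<Rightarrow> nat) set" where
  "cube n = {1..n} \<rightarrow>\<^sub>E {0, 1}"

text \<open>
  For \<open>j \<in> {1..n}\<close> and \<open>b \<in> {0, 1}\<close> the set under \<open>Min\<close> is finite and nonempty; other values of
  \<open>j\<close> and \<open>b\<close> carry no meaning.
\<close>

definition mu_message ::
  "nat \<Rightarrow> ((nat \<Rightarrow> nat) \<Rightarrow> real) \<Rightarrow> nat \<Rightarrow> nat \<Rightarrow> (nat \<Rightarrow> real) \<Rightarrow> real" where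
  "mu_message n F j b \<nu> =
     Min ((\<lambda>x. F x + (\<Sum>k\<in>{1..n} - {j}. \<nu> k * real (x k))) ` {x \<in> cube n. x j = b})"

definition nu_message ::
  "nat \<Rightarrow> ((nat \<Rightarrow> nat) \<Rightarrow> real) \<Rightarrow> nat \<Rightarrow> (nat \<Rightarrow> real) \<Rightarrow> real" where
  "nu_message n F j \<nu> = mu_message n F j 1 \<nu> - mu_message n F j 0 \<nu>"

end

theory Submission
  imports Defs
begin

text \<open>The added factor is linear in \<open>x i\<close>, just like the term
  \<open>\<nu> i * x i\<close> already under the minimum. If \<open>j \<noteq> i\<close>, the two
  merge into one term with coefficient \<open>\<nu> i + \<gamma>\<close>. If \<open>j = i\<close>,
  the sum skips index \<open>i\<close>, and \<open>x i\<close> is fixed to \<open>b\<close>, so the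
  added factor is the constant \<open>\<gamma> * b\<close> and leaves the minimum.
  \<open>mu_message_add_unary\<close> covers both cases; subtracting \<open>b = 0\<close> from
  \<open>b = 1\<close> turns the offset into \<open>\<gamma>\<close> or 0.\<close>

lemma cube_slice_nonempty:
  assumes "j \<in> {1..n}" and "b \<in> {0, 1}"
  shows "{x \<in> cube n. x j = b} \<noteq> {}"
proof -
  have "(\<lambda>k\<in>{1..n}. b) \<in> {x \<in> cube n. x j = b}"
    using assms by (auto simp: cube_def)
  then show ?thesis by blast
qed

lemma finite_cube: "finite (cube n)"
  by (simp add: cube_def finite_PiE)

text \<open>Both minima range over the same slice of the cube, and their objectives differ pointwise
  by an amount that is constant on that slice. The value \<open>b\<close> is kept general because
  this constant depends on it.\<close>

lemma mu_message_add_unary: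
  fixes f h :: "(nat \<Rightarrow> nat) \<Rightarrow> real" and \<gamma> :: real and \<nu> :: "nat \<Rightarrow> real"
  assumes i: "i \<in> {1..n}" and j: "j \<in> {1..n}" and b: "b \<in> {0, 1}"
    and h: "\<And>x. x \<in> cube n \<Longrightarrow> h x = f x + \<gamma> * real (x i)"
  shows "mu_message n h j b \<nu> =
    mu_message n f j b (\<nu>(i := \<nu> i + \<gamma>)) + (if j = i then \<gamma> * real b else 0)"
proof -
  let ?S = "{x \<in> cube n. x j = b}"
  let ?c = "if j = i then \<gamma> * real b else 0"
  let ?\<nu> = "\<nu>(i := \<nu> i + \<gamma>)"
  have shift: "h x + (\<Sum>k\<in>{1..n} - {j}. \<nu> k * real (x k)) =
      f x + (\<Sum>k\<in>{1..n} - {j}. ?\<nu> k * real (x k)) + ?c" if x: "x \<in> ?S" for x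
  proof -
    \<comment> \<open>Changing the coefficient at \<open>i\<close> affects only the summand
      \<open>k = i\<close>, which is present exactly when \<open>j \<noteq> i\<close>.\<close>
    have "(\<Sum>k\<in>{1..n} - {j}. ?\<nu> k * real (x k)) =
        (\<Sum>k\<in>{1..n} - {j}. \<nu> k * real (x k) + (if k = i then \<gamma> * real (x i) else 0))"
      by (rule sum.cong) (auto simp: algebra_simps)
    also have "\<dots> = (\<Sum>k\<in>{1..n} - {j}. \<nu> k * real (x k)) + (if j = i then 0 else \<gamma> * real (x i))"
      using i by (simp add: sum.distrib)
    finally show ?thesis
      \<comment> \<open>For \<open>j = i\<close>, membership in \<open>?S\<close> gives
        \<open>x i = b\<close>, so \<open>\<gamma> * real (x i)\<close> is
        \<open>?c\<close>.\<close>
      using x h[of x] by auto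
  qed
  have "mu_message n h j b \<nu> =
      Min ((\<lambda>x. f x + (\<Sum>k\<in>{1..n} - {j}. ?\<nu> k * real (x k)) + ?c) ` ?S)"
    unfolding mu_message_def using shift by (intro arg_cong[where f = Min] image_cong) auto
  \<comment> \<open>Pulling a constant out of \<open>Min\<close> requires a finite nonempty set; the
    assignment constantly equal to \<open>b\<close> lies in the slice.\<close>
  also have "\<dots> = mu_message n f j b ?\<nu> + ?c"
    unfolding mu_message_def
    using finite_cube[of n] cube_slice_nonempty[OF j b] by (intro Min_add_commute) auto
  finally show ?thesis .
qed

theorem lemma1:
  fixes n i j :: nat
    and f h :: "(nat \<Rightarrow> nat) \<Rightarrow> real"
    and g :: "nat \<Rightarrow> real"
    and \<gamma> :: real
    and \<nu> :: "nat \<Rightarrow> real"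
  assumes "i \<in> {1..n}"
    and "\<And>b. b \<in> {0, 1} \<Longrightarrow> g b = \<gamma> * real b"
    and "\<And>x. x \<in> cube n \<Longrightarrow> h x = f x + g (x i)"
    and "j \<in> {1..n}"
  shows "nu_message n h j \<nu> =
    (if j \<noteq> i then nu_message n f j (\<nu>(i := \<nu> i + \<gamma>))
     else nu_message n f j (\<nu>(i := \<nu> i + \<gamma>)) + \<gamma>)"
proof -
  have h: "h x = f x + \<gamma> * real (x i)" if "x \<in> cube n" for x
  proof -
    \<comment> \<open>The formula for \<open>g\<close> is given only at 0 and 1.\<close>
    have "x i \<in> {0, 1}"
      using that assms(1) by (auto simp: cube_def)
    then show ?thesis
      using assms(2,3) that by auto
  qed
  have "mu_message n h j b \<nu> =
      mu_message n f j b (\<nu>(i := \<nu> i + \<gamma>)) + (if j = i then \<gamma> * real b else 0)"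
    if "b \<in> {0, 1}" for b
    using assms(1,4) that h by (rule mu_message_add_unary)
  from this[of 0] this[of 1] show ?thesis
    by (simp add: nu_message_def)
qed

end
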